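(* (a) There exist embedded ZMC-surfaces of maximal type in $\mathbb{R}^3_1$ each of which contains an entire null line; that is, there exist a domain $U\subset\mathbb{R}^2$ and a smooth embedding $f:U\to\mathbb{R}^3_1$ which is a ZMC-map of maximal type and which contains an entire null line. (b) There exist embedded ZMC-surfaces of mixed type in $\mathbb{R}^3_1$ each of which contains an entire null line; that is, there exist a domain $U\subset\mathbb{R}^2$ and a smooth embedding $f:U\to\mathbb{R}^3_1$ which is a ZMC-map of mixed type and which contains an entire null line.
   Context: $\mathbb{R}^3_1$ is the Lorentz-Minkowski 3-space, i.e. $\mathbb{R}^3$ with the inner product $\cdot$ of signature $(++-)$: $(x_1,y_1,t_1)\cdot(x_2,y_2,t_2)=x_1x_2+y_1y_2-t_1t_2$. A domain is a nonempty connected open set. Let $U$ be a domain in the $uv$-plane and $f:U\to\mathbb{R}^3_1$ a smooth map. Set $$P:=\begin{pmatrix} f_u\cdot f_u & f_u\cdot f_v\\ f_v\cdot f_u & f_v\cdot f_v\end{pmatrix},\qquad B_f:=\det(P),$$ $$\tilde\nu:=\begin{pmatrix}1&0&0\\0&1&0\\0&0&-1\end{pmatrix}(f_u\times_E f_v),\qquad Q:=\begin{pmatrix} f_{uu}\cdot\tilde\nu & f_{uv}\cdot\tilde\nu\\ f_{vu}\cdot\tilde\nu & f_{vv}\cdot\tilde\nu\end{pmatrix},$$ where $\times_E$ is the Euclidean vector product of $\mathbb{R}^3$, and $A_f:=\operatorname{trace}(\tilde P Q)$, where $\tilde P$ is the cofactor matrix (adjugate) of $P$. The map $f$ is called a ZMC-map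 (zero mean curvature map) if it is an immersion on an open dense subset of $U$ and $A_f$ vanishes identically on $U$. For a ZMC-map $f$, a point $p\in U$ is space-like if $B_f(p)>0$, time-like if $B_f(p)<0$, and a null point if $B_f(p)=0$. A ZMC-map $f$ is of maximal type if $B_f\ge 0$ on $U$ but $B_f$ does not vanish identically; it is of mixed type if $B_f$ changes sign on $U$ (takes both positive and negative values). A light-like line in $\mathbb{R}^3_1$ is a (complete) affine line whose direction vector $w\neq 0$ satisfies $w\cdot w=0$. A ZMC-map $f:U\to\mathbb{R}^3_1$ contains an entire null line if there exist an open interval $I$ and a smooth curve $\gamma:I\to U$ such that $\gamma(I)$ consists only of null points of $f$ and $f\circ\gamma(I)$ coincides with a complete light-like line in $\mathbb{R}^3_1$. *)

theory Defs
  imports "HOL-Analysis.Analysis"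
begin

definition planar_domain :: "(real \<times> real) set \<Rightarrow> bool" where
  "planar_domain U \<longleftrightarrow> U \<noteq> {} \<and> open U \<and> connected U"

(* C^k on an open set S: f is k times (Frechet) differentiable and its iterated
   derivatives, evaluated in arbitrary fixed directions, are continuous. The values
   of f outside S are irrelevant when S is open. *)
fun Ck_on :: "nat \<Rightarrow> 'a::euclidean_space set \<Rightarrow> ('a \<Rightarrow> 'b::euclidean_space) \<Rightarrow> bool" where
  "Ck_on 0 S f \<longleftrightarrow> continuous_on S f"
| "Ck_on (Suc k) S f \<longleftrightarrow>
     (\<forall>x\<in>S. f differentiable (at x)) \<and>
     (\<forall>v. Ck_on k S (\<lambda>x. frechet_derivative f (at x) v))"

definition smooth_on :: "'a::euclidean_space set \<Rightarrow> ('a \<Rightarrow> 'b::euclidean_space) \<Rightarrow> bool" where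
  "smooth_on S f \<longleftrightarrow> (\<forall>k. Ck_on k S f)"

definition immersion_at :: "(real \<times> real \<Rightarrow> real^3) \<Rightarrow> real \<times> real \<Rightarrow> bool" where
  "immersion_at f p \<longleftrightarrow> f differentiable (at p) \<and> inj (frechet_derivative f (at p))"

definition smooth_embedding :: "(real \<times> real) set \<Rightarrow> (real \<times> real \<Rightarrow> real^3) \<Rightarrow> bool" where
  "smooth_embedding U f \<longleftrightarrow>
     smooth_on U f \<and> (\<forall>p\<in>U. immersion_at f p) \<and> (\<exists>g. homeomorphism U (f ` U) f g)"

definition lorentz :: "real^3 \<Rightarrow> real^3 \<Rightarrow> real" (infixl \<open>\<bullet>\<^sub>L\<close> 70) where
  "x \<bullet>\<^sub>L y = x$1 * y$1 + x$2 * y$2 - x$3 * y$3"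

definition pd_u :: "(real \<times> real \<Rightarrow> real^3) \<Rightarrow> real \<times> real \<Rightarrow> real^3" where
  "pd_u f p = vector_derivative (\<lambda>s. f (s, snd p)) (at (fst p))"

definition pd_v :: "(real \<times> real \<Rightarrow> real^3) \<Rightarrow> real \<times> real \<Rightarrow> real^3" where
  "pd_v f p = vector_derivative (\<lambda>s. f (fst p, s)) (at (snd p))"

definition P_mat :: "(real \<times> real \<Rightarrow> real^3) \<Rightarrow> real \<times> real \<Rightarrow> real^2^2" where
  "P_mat f p = vector
     [vector [pd_u f p \<bullet>\<^sub>L pd_u f p, pd_u f p \<bullet>\<^sub>L pd_v f p],
      vector [pd_v f p \<bullet>\<^sub>L pd_u f p, pd_v f p \<bullet>\<^sub>L pd_v f p]]"

definition B_fun :: "(real \<times> real \<Rightarrow> real^3) \<Rightarrow> real \<times> real \<Rightarrow> real" where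
  "B_fun f p = det (P_mat f p)"

definition nu_tilde :: "(real \<times> real \<Rightarrow> real^3) \<Rightarrow> real \<times> real \<Rightarrow> real^3" where
  "nu_tilde f p =
     (vector [vector [1, 0, 0], vector [0, 1, 0], vector [0, 0, -1]] :: real^3^3)
       *v cross3 (pd_u f p) (pd_v f p)"

(* f_uv = (f_u)_v, and f_vu = (f_v)_u. *)
definition Q_mat :: "(real \<times> real \<Rightarrow> real^3) \<Rightarrow> real \<times> real \<Rightarrow> real^2^2" where
  "Q_mat f p = vector
     [vector [pd_u (pd_u f) p \<bullet>\<^sub>L nu_tilde f p, pd_v (pd_u f) p \<bullet>\<^sub>L nu_tilde f p],
      vector [pd_u (pd_v f) p \<bullet>\<^sub>L nu_tilde f p, pd_v (pd_v f) p \<bullet>\<^sub>L nu_tilde f p]]"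

definition adjugate2 :: "real^2^2 \<Rightarrow> real^2^2" where
  "adjugate2 M = vector [vector [M$2$2, - M$1$2], vector [- M$2$1, M$1$1]]"

definition A_fun :: "(real \<times> real \<Rightarrow> real^3) \<Rightarrow> real \<times> real \<Rightarrow> real" where
  "A_fun f p = trace (adjugate2 (P_mat f p) ** Q_mat f p)"

definition ZMC_map :: "(real \<times> real) set \<Rightarrow> (real \<times> real \<Rightarrow> real^3) \<Rightarrow> bool" where
  "ZMC_map U f \<longleftrightarrow>
     planar_domain U \<and> smooth_on U f \<and>
     (\<exists>W. open W \<and> W \<subseteq> U \<and> U \<subseteq> closure W \<and> (\<forall>p\<in>W. immersion_at f p)) \<and>
     (\<forall>p\<in>U. A_fun f p = 0)"

definition null_point :: "(real \<times> real \<Rightarrow> real^3) \<Rightarrow> real \<times> real \<Rightarrow> bool" where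
  "null_point f p \<longleftrightarrow> B_fun f p = 0"

definition maximal_type :: "(real \<times> real) set \<Rightarrow> (real \<times> real \<Rightarrow> real^3) \<Rightarrow> bool" where
  "maximal_type U f \<longleftrightarrow>
     ZMC_map U f \<and> (\<forall>p\<in>U. B_fun f p \<ge> 0) \<and> \<not> (\<forall>p\<in>U. B_fun f p = 0)"

definition mixed_type :: "(real \<times> real) set \<Rightarrow> (real \<times> real \<Rightarrow> real^3) \<Rightarrow> bool" where
  "mixed_type U f \<longleftrightarrow>
     ZMC_map U f \<and> (\<exists>p\<in>U. B_fun f p > 0) \<and> (\<exists>q\<in>U. B_fun f q < 0)"

definition light_like_line :: "(real^3) set \<Rightarrow> bool" where
  "light_like_line L \<longleftrightarrow>
     (\<exists>a w. w \<noteq> 0 \<and> w \<bullet>\<^sub>L w = 0 \<and> L = range (\<lambda>s::real. a + s *\<^sub>R w))"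

(* An open interval is allowed to be unbounded. *)
definition contains_entire_null_line ::
    "(real \<times> real) set \<Rightarrow> (real \<times> real \<Rightarrow> real^3) \<Rightarrow> bool" where
  "contains_entire_null_line U f \<longleftrightarrow>
     (\<exists>(I::real set) \<gamma>. open I \<and> is_interval I \<and> I \<noteq> {} \<and>
        smooth_on I \<gamma> \<and> \<gamma> ` I \<subseteq> U \<and> (\<forall>t\<in>I. null_point f (\<gamma> t)) \<and>
        light_like_line ((f \<circ> \<gamma>) ` I))"

end

theory Submission
  imports Defs
begin

text \<open>
  In the coordinates x, a = (t + y) / 2, b = (t - y) / 2 the metric is dx^2 - 4 da db, and the
  time-like (maximal) surfaces of zero mean curvature are the sums of two null curves (the real
  parts of holomorphic null curves). A pole of a at a point where x and b vanish spreads this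
  point out into a complete null line.

  For mixed type take c(p) + c(q) with c(p) = (p^2 / 2, - 1 / p, p^5 / 20). In terms of u = - p q
  and v = a this sum is polynomial, hence extends beyond the time-like region p, q real.
  For maximal type take the real part of (- i z / 2, - 2 / z, - z^3 / 96), where
  z = 2 i u / (1 - i u v). Both maps send the axis u = 0 onto the null line x = b = 0.
\<close>

section \<open>Closure properties of C^k and smooth functions on open sets\<close>

text \<open>Openness of \<open>S\<close> makes the Frechet derivative local, so agreement on
  \<open>S\<close> passes to every directional derivative and the induction runs.\<close>

lemma Ck_on_cong:
  assumes "open S" "\<And>x. x \<in> S \<Longrightarrow> f x = g x" "Ck_on k S f"
  shows "Ck_on k S g"
  using assms(2,3)
proof (induction k arbitrary: f g)
  case 0
  then show ?case by (simp cong: continuous_on_cong)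
next
  case (Suc k)
  have D: "(g has_derivative frechet_derivative f (at x)) (at x)" if "x \<in> S" for x
  proof (rule has_derivative_transform_within_open[OF _ assms(1) that])
    show "(f has_derivative frechet_derivative f (at x)) (at x)"
      using Suc.prems(2) that by (simp add: frechet_derivative_works[symmetric])
  qed (use Suc.prems in auto)
  have "frechet_derivative f (at x) = frechet_derivative g (at x)" if "x \<in> S" for x
    using frechet_derivative_at[OF D[OF that]] .
  then have "Ck_on k S (\<lambda>x. frechet_derivative g (at x) v)" for v
    using Suc.IH[of "\<lambda>x. frechet_derivative f (at x) v" "\<lambda>x. frechet_derivative g (at x) v"]
      Suc.prems(2) by simp
  with D show ?case by (auto simp: differentiable_def)
qed

text \<open>Lets the later inductions name the derivative by a formula: \<open>f'\<close> agrees
  with \<open>frechet_derivative\<close> only on \<open>S\<close>, and congruence bridges the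
  gap.\<close>

lemma Ck_on_SucI:
  assumes "open S" "\<And>x. x \<in> S \<Longrightarrow> (f has_derivative f' x) (at x)"
    and "\<And>v. Ck_on k S (\<lambda>x. f' x v)"
  shows "Ck_on (Suc k) S f"
proof -
  have "f' x = frechet_derivative f (at x)" if "x \<in> S" for x
    using frechet_derivative_at[OF assms(2)[OF that]] .
  then have "Ck_on k S (\<lambda>x. frechet_derivative f (at x) v)" for v
    using Ck_on_cong[OF assms(1) _ assms(3)[of v]] by simp
  with assms(2) show ?thesis by (auto simp: differentiable_def)
qed

lemma Ck_on_SucD: "Ck_on (Suc k) S f \<Longrightarrow> Ck_on k S f"
proof (induction k arbitrary: f)
  case 0
  then show ?case
    by (auto intro!: continuous_at_imp_continuous_on differentiable_imp_continuous_within)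
next
  case (Suc k)
  then show ?case by (metis Ck_on.simps(2))
qed

lemma Ck_on_const [simp]: "Ck_on k S (\<lambda>x. c)"
  by (induction k arbitrary: c) (auto simp: frechet_derivative_const)

lemma Ck_on_bounded_linear:
  assumes "bounded_linear f"
  shows "Ck_on k S f"
proof (cases k)
  case 0
  then show ?thesis by (simp add: assms linear_continuous_on)
next
  case (Suc n)
  have "frechet_derivative f (at x) = f" for x
    using frechet_derivative_at[OF bounded_linear_imp_has_derivative[OF assms]] by simp
  with Suc assms show ?thesis
    by (auto intro: bounded_linear_imp_differentiable)
qed

lemma Ck_on_add:
  assumes "open S" "Ck_on k S f" "Ck_on k S g"
  shows "Ck_on k S (\<lambda>x. f x + g x)"
  using assms(2,3)
proof (induction k arbitrary: f g)
  case 0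
  then show ?case by (simp add: continuous_on_add)
next
  case (Suc k)
  then show ?case
    by (intro Ck_on_SucI[OF assms(1),
          where f' = "\<lambda>x v. frechet_derivative f (at x) v + frechet_derivative g (at x) v"])
      (auto simp: frechet_derivative_works[symmetric] intro!: has_derivative_add)
qed

lemma Ck_on_mult:
  fixes f g :: "'a::euclidean_space \<Rightarrow> real"
  assumes "open S" "Ck_on k S f" "Ck_on k S g"
  shows "Ck_on k S (\<lambda>x. f x * g x)"
  using assms(2,3)
proof (induction k arbitrary: f g)
  case 0
  then show ?case by (simp add: continuous_on_mult)
next
  case (Suc k)
  \<comment> \<open>The product rule keeps one factor undifferentiated; \<open>Ck_on_SucD\<close>
    lowers that factor to order \<open>k\<close>, where the induction hypothesis applies.\<close>
  have "Ck_on k S (\<lambda>x. f x * frechet_derivative g (at x) v + frechet_derivative f (at x) v * g x)" for v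
    using Suc.prems Ck_on_SucD[OF Suc.prems(1)] Ck_on_SucD[OF Suc.prems(2)]
    by (intro Ck_on_add assms(1) Suc.IH) auto
  with Suc.prems show ?case
    by (intro Ck_on_SucI[OF assms(1), where f' =
          "\<lambda>x v. f x * frechet_derivative g (at x) v + frechet_derivative f (at x) v * g x"])
      (auto simp: frechet_derivative_works[symmetric] intro!: has_derivative_mult)
qed

lemma Ck_on_inverse:
  fixes f :: "'a::euclidean_space \<Rightarrow> real"
  assumes "open S" "Ck_on k S f" "\<And>x. x \<in> S \<Longrightarrow> f x \<noteq> 0"
  shows "Ck_on k S (\<lambda>x. inverse (f x))"
  using assms(2)
proof (induction k)
  case 0
  then show ?case using assms(3) by (simp add: continuous_on_inverse)
next
  case (Suc k)
  \<comment> \<open>The derivative of the inverse contains the inverse again, one order lower, so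
    the induction hypothesis covers it. The sign is a constant factor in order to fall under
    \<open>Ck_on_mult\<close>.\<close>
  have "Ck_on k S (\<lambda>x. (-1) * (inverse (f x) * frechet_derivative f (at x) v * inverse (f x)))" for v
    using Suc.prems Suc.IH[OF Ck_on_SucD[OF Suc.prems]] by (intro Ck_on_mult assms(1)) auto
  then have "Ck_on k S (\<lambda>x. - (inverse (f x) * frechet_derivative f (at x) v * inverse (f x)))" for v
    by simp
  with Suc.prems assms(3) show ?case
    by (intro Ck_on_SucI[OF assms(1), where f' =
          "\<lambda>x v. - (inverse (f x) * frechet_derivative f (at x) v * inverse (f x))"])
      (auto simp: frechet_derivative_works[symmetric] intro!: has_derivative_inverse)
qed

text \<open>Taking the component along a fixed \<open>b\<close> commutes with differentiation, so
  the hypothesis is inherited by the directional derivatives.\<close>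

lemma Ck_on_componentwise:
  fixes f :: "'a::euclidean_space \<Rightarrow> 'b::euclidean_space"
  assumes "open S" "\<And>b. b \<in> Basis \<Longrightarrow> Ck_on k S (\<lambda>x. f x \<bullet> b)"
  shows "Ck_on k S f"
  using assms(2)
proof (induction k arbitrary: f)
  case 0
  then show ?case by (simp add: continuous_on_componentwise[of S f])
next
  case (Suc k)
  have diff: "f differentiable (at x)" if "x \<in> S" for x
    using Suc.prems that by (subst differentiable_componentwise_within) auto
  have "frechet_derivative (\<lambda>y. f y \<bullet> b) (at x) v = frechet_derivative f (at x) v \<bullet> b"
    if "x \<in> S" for x b v
    using frechet_derivative_at[OF has_derivative_inner_left[OF
        diff[OF that, unfolded frechet_derivative_works]], of b] by metis
  then have "Ck_on k S (\<lambda>x. frechet_derivative f (at x) v \<bullet> b)" if "b \<in> Basis" for b v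
    using Suc.prems[OF that] Ck_on_cong[OF assms(1),
      of "\<lambda>x. frechet_derivative (\<lambda>y. f y \<bullet> b) (at x) v"] by simp
  with diff show ?case by (auto intro: Suc.IH)
qed

lemma smooth_on_const [simp]: "smooth_on S (\<lambda>x. c)"
  by (simp add: smooth_on_def)

lemma smooth_on_bounded_linear: "bounded_linear f \<Longrightarrow> smooth_on S f"
  by (simp add: smooth_on_def Ck_on_bounded_linear)

lemma smooth_on_add:
  "open S \<Longrightarrow> smooth_on S f \<Longrightarrow> smooth_on S g \<Longrightarrow> smooth_on S (\<lambda>x. f x + g x)"
  by (simp add: smooth_on_def Ck_on_add)

lemma smooth_on_mult:
  fixes f g :: "'a::euclidean_space \<Rightarrow> real"
  shows "open S \<Longrightarrow> smooth_on S f \<Longrightarrow> smooth_on S g \<Longrightarrow> smooth_on S (\<lambda>x. f x * g x)"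
  by (simp add: smooth_on_def Ck_on_mult)

lemma smooth_on_minus:
  fixes f :: "'a::euclidean_space \<Rightarrow> real"
  assumes "open S" "smooth_on S f"
  shows "smooth_on S (\<lambda>x. - f x)"
  using smooth_on_mult[OF assms(1) smooth_on_const[of S "-1"] assms(2)] by simp

lemma smooth_on_diff:
  fixes f g :: "'a::euclidean_space \<Rightarrow> real"
  assumes "open S" "smooth_on S f" "smooth_on S g"
  shows "smooth_on S (\<lambda>x. f x - g x)"
  using smooth_on_add[OF assms(1,2) smooth_on_minus[OF assms(1,3)]] by simp

lemma smooth_on_power:
  fixes f :: "'a::euclidean_space \<Rightarrow> real"
  assumes "open S" "smooth_on S f"
  shows "smooth_on S (\<lambda>x. f x ^ n)"
  by (induction n) (auto intro: smooth_on_mult assms)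

lemma smooth_on_inverse:
  fixes f :: "'a::euclidean_space \<Rightarrow> real"
  shows "open S \<Longrightarrow> smooth_on S f \<Longrightarrow> (\<And>x. x \<in> S \<Longrightarrow> f x \<noteq> 0) \<Longrightarrow> smooth_on S (\<lambda>x. inverse (f x))"
  by (simp add: smooth_on_def Ck_on_inverse)

lemma smooth_on_vector3:
  fixes x y z :: "'a::euclidean_space \<Rightarrow> real"
  assumes "open S" "smooth_on S x" "smooth_on S y" "smooth_on S z"
  shows "smooth_on S (\<lambda>p. vector [x p, y p, z p] :: real^3)"
  unfolding smooth_on_def
proof (rule allI, rule Ck_on_componentwise[OF assms(1)])
  fix k and b :: "real^3"
  assume "b \<in> Basis"
  then obtain i where "b = axis i 1" by (auto simp: Basis_vec_def)
  then show "Ck_on k S (\<lambda>p. (vector [x p, y p, z p] :: real^3) \<bullet> b)"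
    using assms(2-4) exhaust_3[of i] by (auto simp: inner_axis smooth_on_def)
qed

lemmas smooth_on_intros =
  smooth_on_const
  smooth_on_bounded_linear[OF bounded_linear_fst] smooth_on_bounded_linear[OF bounded_linear_snd]
  smooth_on_add smooth_on_diff smooth_on_mult smooth_on_power smooth_on_inverse smooth_on_vector3

lemma smooth_on_imp_continuous_on: "smooth_on S f \<Longrightarrow> continuous_on S f"
  unfolding smooth_on_def by (metis Ck_on.simps(1))

section \<open>Symbolic computation of partial derivatives\<close>

text \<open>A total derivative at every point of the plane: the formulas of both surfaces are
  differentiable everywhere, so the rules carry no condition on the point, and the chain rule then
  yields \<open>pd_u\<close> and \<open>pd_v\<close>.\<close>

definition has_partials ::
    "(real \<times> real \<Rightarrow> real) \<Rightarrow> (real \<times> real \<Rightarrow> real) \<Rightarrow> (real \<times> real \<Rightarrow> real) \<Rightarrow> bool" where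
  "has_partials g gu gv \<longleftrightarrow>
     (\<forall>p. (g has_derivative (\<lambda>h. fst h * gu p + snd h * gv p)) (at p))"

lemma has_partials_eqI:
  assumes "has_partials g gu gv" "\<And>p. gu p = gu' p" "\<And>p. gv p = gv' p"
  shows "has_partials g gu' gv'"
  using assms by (simp add: has_partials_def)

lemma has_partials_const: "has_partials (\<lambda>p. c) (\<lambda>p. 0) (\<lambda>p. 0)"
  by (simp add: has_partials_def)

lemma has_partials_fst: "has_partials fst (\<lambda>p. 1) (\<lambda>p. 0)"
  by (auto simp: has_partials_def intro!: derivative_eq_intros)

lemma has_partials_snd: "has_partials snd (\<lambda>p. 0) (\<lambda>p. 1)"
  by (auto simp: has_partials_def intro!: derivative_eq_intros)

lemma has_partials_add:
  assumes "has_partials f fu fv" "has_partials g gu gv"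
  shows "has_partials (\<lambda>p. f p + g p) (\<lambda>p. fu p + gu p) (\<lambda>p. fv p + gv p)"
  using assms unfolding has_partials_def
  by (auto intro!: derivative_eq_intros simp: algebra_simps)

lemma has_partials_diff:
  assumes "has_partials f fu fv" "has_partials g gu gv"
  shows "has_partials (\<lambda>p. f p - g p) (\<lambda>p. fu p - gu p) (\<lambda>p. fv p - gv p)"
  using assms unfolding has_partials_def
  by (auto intro!: derivative_eq_intros simp: algebra_simps)

lemma has_partials_mult:
  assumes "has_partials f fu fv" "has_partials g gu gv"
  shows "has_partials (\<lambda>p. f p * g p) (\<lambda>p. fu p * g p + f p * gu p) (\<lambda>p. fv p * g p + f p * gv p)"
  using assms unfolding has_partials_def
  by (auto intro!: derivative_eq_intros simp: algebra_simps)

lemma has_partials_power_numeral: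
  assumes "has_partials f fu fv"
  shows "has_partials (\<lambda>p. f p ^ numeral n)
           (\<lambda>p. numeral n * f p ^ pred_numeral n * fu p) (\<lambda>p. numeral n * f p ^ pred_numeral n * fv p)"
  using assms unfolding has_partials_def
  by (auto intro!: derivative_eq_intros simp: algebra_simps)

lemma has_partials_inverse:
  assumes "has_partials f fu fv" "\<And>p. f p \<noteq> 0"
  shows "has_partials (\<lambda>p. inverse (f p)) (\<lambda>p. - fu p * inverse (f p) ^ 2) (\<lambda>p. - fv p * inverse (f p) ^ 2)"
  using assms unfolding has_partials_def
  by (auto intro!: derivative_eq_intros simp: algebra_simps power2_eq_square)

lemmas has_partials_intros =
  has_partials_const has_partials_fst has_partials_snd has_partials_add has_partials_diff
  has_partials_mult has_partials_power_numeral

lemma has_derivative_vector3: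
  fixes x y z :: "'a::euclidean_space \<Rightarrow> real"
  assumes "(x has_derivative x') (at p)" "(y has_derivative y') (at p)" "(z has_derivative z') (at p)"
  shows "((\<lambda>p. vector [x p, y p, z p] :: real^3) has_derivative
           (\<lambda>h. vector [x' h, y' h, z' h])) (at p)"
proof (subst has_derivative_componentwise_within, intro ballI)
  fix b :: "real^3"
  assume "b \<in> Basis"
  then obtain i where "b = axis i 1" by (auto simp: Basis_vec_def)
  then show "((\<lambda>p. (vector [x p, y p, z p] :: real^3) \<bullet> b) has_derivative
      (\<lambda>h. (vector [x' h, y' h, z' h] :: real^3) \<bullet> b)) (at p)"
    using assms exhaust_3[of i] by (auto simp: inner_axis)
qed

lemma partial_derivatives_eqI:
  fixes f :: "real \<times> real \<Rightarrow> real^3"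
  assumes "(f has_derivative (\<lambda>h. fst h *\<^sub>R a + snd h *\<^sub>R c)) (at p)"
  shows "pd_u f p = a" "pd_v f p = c"
proof -
  have "((\<lambda>s. (s, snd p)) has_derivative (\<lambda>s. (s, 0))) (at (fst p))"
    by (auto intro!: derivative_eq_intros)
  then have "((\<lambda>s. f (s, snd p)) has_vector_derivative a) (at (fst p))"
    using has_derivative_compose[of "\<lambda>s. (s, snd p)" "\<lambda>s. (s, 0)" "fst p" UNIV f] assms
    by (fastforce simp: has_vector_derivative_def)
  then show "pd_u f p = a"
    by (simp add: pd_u_def vector_derivative_at)
  have "((\<lambda>s. (fst p, s)) has_derivative (\<lambda>s. (0, s))) (at (snd p))"
    by (auto intro!: derivative_eq_intros)
  then have "((\<lambda>s. f (fst p, s)) has_vector_derivative c) (at (snd p))"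
    using has_derivative_compose[of "\<lambda>s. (fst p, s)" "\<lambda>s. (0, s)" "snd p" UNIV f] assms
    by (fastforce simp: has_vector_derivative_def)
  then show "pd_v f p = c"
    by (simp add: pd_v_def vector_derivative_at)
qed

section \<open>Surfaces in light-cone coordinates\<close>

text \<open>The null coordinate a is the second parameter v itself, so a surface is given by x and b
  as functions of (u, v). One function serves for both mixed derivatives of each.\<close>

locale light_cone_map =
  fixes X Xu Xv Xuu Xuv Xvv b bu bv buu buv bvv :: "real \<times> real \<Rightarrow> real"
  assumes partials_X: "has_partials X Xu Xv" "has_partials Xu Xuu Xuv" "has_partials Xv Xuv Xvv"
    and partials_b: "has_partials b bu bv" "has_partials bu buu buv" "has_partials bv buv bvv"
begin

text \<open>Return to the standard coordinates: y = a - b and t = a + b with a = v.\<close>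

definition f :: "real \<times> real \<Rightarrow> real^3" where
  "f p = vector [X p, snd p - b p, snd p + b p]"

lemma has_derivative_f:
  "(f has_derivative (\<lambda>h. fst h *\<^sub>R vector [Xu p, - bu p, bu p] +
      snd h *\<^sub>R vector [Xv p, 1 - bv p, 1 + bv p])) (at p)"
proof -
  have D: "(X has_derivative (\<lambda>h. fst h * Xu p + snd h * Xv p)) (at p)"
    "(b has_derivative (\<lambda>h. fst h * bu p + snd h * bv p)) (at p)"
    using partials_X(1) partials_b(1) unfolding has_partials_def by blast+
  have "(f has_derivative (\<lambda>h. vector [fst h * Xu p + snd h * Xv p,
      snd h - (fst h * bu p + snd h * bv p), snd h + (fst h * bu p + snd h * bv p)])) (at p)"
    unfolding f_def by (intro has_derivative_vector3 D derivative_intros)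
  then show ?thesis
    by (rule has_derivative_eq_rhs) (simp add: fun_eq_iff vec_eq_iff forall_3 algebra_simps)
qed

lemma pd_f:
  "pd_u f = (\<lambda>p. vector [Xu p, - bu p, bu p])"
  "pd_v f = (\<lambda>p. vector [Xv p, 1 - bv p, 1 + bv p])"
  using partial_derivatives_eqI[OF has_derivative_f] by auto

lemma second_pd_f:
  "pd_u (pd_u f) p = vector [Xuu p, - buu p, buu p]"
  "pd_v (pd_u f) p = vector [Xuv p, - buv p, buv p]"
  "pd_u (pd_v f) p = vector [Xuv p, - buv p, buv p]"
  "pd_v (pd_v f) p = vector [Xvv p, - bvv p, bvv p]"
proof -
  have D: "(Xu has_derivative (\<lambda>h. fst h * Xuu p + snd h * Xuv p)) (at p)"
    "(Xv has_derivative (\<lambda>h. fst h * Xuv p + snd h * Xvv p)) (at p)"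
    "(bu has_derivative (\<lambda>h. fst h * buu p + snd h * buv p)) (at p)"
    "(bv has_derivative (\<lambda>h. fst h * buv p + snd h * bvv p)) (at p)"
    using partials_X partials_b unfolding has_partials_def by blast+
  have "(pd_u f has_derivative (\<lambda>h. vector [fst h * Xuu p + snd h * Xuv p,
      - (fst h * buu p + snd h * buv p), fst h * buu p + snd h * buv p])) (at p)"
    unfolding pd_f by (intro has_derivative_vector3 D derivative_intros)
  then have U: "(pd_u f has_derivative (\<lambda>h. fst h *\<^sub>R vector [Xuu p, - buu p, buu p] +
      snd h *\<^sub>R vector [Xuv p, - buv p, buv p])) (at p)"
    by (rule has_derivative_eq_rhs) (simp add: fun_eq_iff vec_eq_iff forall_3 algebra_simps)
  \<comment> \<open>The zeros are the derivatives of the constant 1, kept so that the result has the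
    shape produced by \<open>derivative_intros\<close>.\<close>
  have "(pd_v f has_derivative (\<lambda>h. vector [fst h * Xuv p + snd h * Xvv p,
      0 - (fst h * buv p + snd h * bvv p), 0 + (fst h * buv p + snd h * bvv p)])) (at p)"
    unfolding pd_f by (intro has_derivative_vector3 D derivative_intros)
  then have V: "(pd_v f has_derivative (\<lambda>h. fst h *\<^sub>R vector [Xuv p, - buv p, buv p] +
      snd h *\<^sub>R vector [Xvv p, - bvv p, bvv p])) (at p)"
    by (rule has_derivative_eq_rhs) (simp add: fun_eq_iff vec_eq_iff forall_3 algebra_simps)
  show "pd_u (pd_u f) p = vector [Xuu p, - buu p, buu p]"
    "pd_v (pd_u f) p = vector [Xuv p, - buv p, buv p]"
    "pd_u (pd_v f) p = vector [Xuv p, - buv p, buv p]"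
    "pd_v (pd_v f) p = vector [Xvv p, - bvv p, bvv p]"
    using partial_derivatives_eqI[OF U] partial_derivatives_eqI[OF V] by auto
qed

text \<open>The pullback of dx^2 - 4 da db, where a = v has derivatives 0 and 1.\<close>

lemma P_mat_f:
  "P_mat f p = vector [vector [(Xu p)\<^sup>2, Xu p * Xv p - 2 * bu p],
                       vector [Xu p * Xv p - 2 * bu p, (Xv p)\<^sup>2 - 4 * bv p]]"
  by (simp add: P_mat_def pd_f lorentz_def vec_eq_iff forall_2 power2_eq_square algebra_simps)

lemma B_fun_f:
  "B_fun f p = (Xu p)\<^sup>2 * ((Xv p)\<^sup>2 - 4 * bv p) - (Xu p * Xv p - 2 * bu p)\<^sup>2"
  by (simp add: B_fun_def P_mat_f det_2 power2_eq_square)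

text \<open>The sign in \<open>nu_tilde\<close> cancels the one in the Lorentz product, leaving a
  determinant with the two first partial derivatives. Vectors of this shape suffice, since all
  second derivatives of a = v vanish.\<close>

lemma lorentz_nu_tilde_f:
  "vector [x, - y, y] \<bullet>\<^sub>L nu_tilde f p = 2 * (y * Xu p - bu p * x)"
  by (simp add: nu_tilde_def pd_f lorentz_def cross3_def matrix_vector_mult_def sum_3 algebra_simps)

lemma A_fun_f:
  "A_fun f p = 2 * (((Xv p)\<^sup>2 - 4 * bv p) * (buu p * Xu p - bu p * Xuu p)
     - 2 * (Xu p * Xv p - 2 * bu p) * (buv p * Xu p - bu p * Xuv p)
     + (Xu p)\<^sup>2 * (bvv p * Xu p - bu p * Xvv p))"
  by (simp add: A_fun_def P_mat_f Q_mat_def second_pd_f lorentz_nu_tilde_f adjugate2_def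
      trace_def matrix_matrix_mult_def sum_2 algebra_simps)

lemma immersion_at_f:
  assumes "Xu p \<noteq> 0"
  shows "immersion_at f p"
proof -
  let ?D = "\<lambda>h. fst h *\<^sub>R vector [Xu p, - bu p, bu p] +
      snd h *\<^sub>R (vector [Xv p, 1 - bv p, 1 + bv p] :: real^3)"
  have "inj ?D"
  proof (rule injI)
    fix h k :: "real \<times> real"
    assume eq: "?D h = ?D k"
    \<comment> \<open>In y + t = 2 a the function b cancels, which isolates the second coordinate;
      the first component then gives the other one because \<open>Xu p\<close> is nonzero.\<close>
    have "?D h $ 2 + ?D h $ 3 = ?D k $ 2 + ?D k $ 3" using eq by simp
    then have "snd h = snd k" by (simp add: algebra_simps)
    moreover have "?D h $ 1 = ?D k $ 1" using eq by simp
    ultimately show "h = k" using assms by (simp add: prod_eq_iff)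
  qed
  then show ?thesis
    using has_derivative_f[of p] frechet_derivative_at[OF has_derivative_f[of p]]
    by (auto simp: immersion_at_def differentiable_def)
qed

text \<open>Since v = (y + t) / 2 can be read off the image, a continuous inverse only requires a
  function \<open>s\<close> recovering u from x and v.\<close>

lemma smooth_embedding_f:
  assumes "open U" "smooth_on U X" "smooth_on U b" "\<And>p. p \<in> U \<Longrightarrow> Xu p \<noteq> 0"
    and "continuous_on (f ` U) (\<lambda>x. s (x$1) ((x$2 + x$3) / 2))"
    and "\<And>p. p \<in> U \<Longrightarrow> s (X p) (snd p) = fst p"
  shows "smooth_embedding U f"
proof -
  have "smooth_on U f"
    unfolding f_def by (intro smooth_on_intros assms)
  moreover have "homeomorphism U (f ` U) f (\<lambda>x. (s (x$1) ((x$2 + x$3) / 2), (x$2 + x$3) / 2))"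
    using smooth_on_imp_continuous_on[OF \<open>smooth_on U f\<close>] assms(5,6)
    by (intro homeomorphismI) (auto simp: f_def intro!: continuous_intros)
  ultimately show ?thesis
    using assms(4) immersion_at_f by (auto simp: smooth_embedding_def)
qed

text \<open>The curve is the whole axis u = 0, mapped to the points (0, v, v), a line of light-like
  direction (0, 1, 1).\<close>

lemma contains_entire_null_line_f:
  assumes "\<And>v. (0, v) \<in> U" "\<And>v. X (0, v) = 0" "\<And>v. b (0, v) = 0" "\<And>v. B_fun f (0, v) = 0"
  shows "contains_entire_null_line U f"
proof -
  let ?\<gamma> = "\<lambda>v::real. (0::real, v)"
  have "bounded_linear ?\<gamma>"
    by (intro bounded_linear_Pair bounded_linear_zero bounded_linear_ident)
  then have "smooth_on UNIV ?\<gamma>" by (rule smooth_on_bounded_linear)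
  moreover have "light_like_line ((f \<circ> ?\<gamma>) ` UNIV)"
    unfolding light_like_line_def
    by (rule exI[of _ 0], rule exI[of _ "vector [0, 1, 1]"])
      (auto simp: lorentz_def f_def assms vec_eq_iff forall_3 intro!: image_cong)
  ultimately show ?thesis
    unfolding contains_entire_null_line_def
    using assms by (intro exI[of _ UNIV] exI[of _ ?\<gamma>]) (auto simp: null_point_def)
qed

end

section \<open>The ZMC property of embeddings, and the common domain\<close>

lemma ZMC_map_if_smooth_embedding:
  assumes "planar_domain U" "smooth_embedding U f" "\<And>p. p \<in> U \<Longrightarrow> A_fun f p = 0"
  shows "ZMC_map U f"
  using assms closure_subset[of U]
  by (auto simp: ZMC_map_def smooth_embedding_def planar_domain_def intro!: exI[of _ U])

text \<open>Small enough for both maps to be injective immersions, and still starlike.\<close>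

definition axis_neighbourhood :: "(real \<times> real) set" where
  "axis_neighbourhood = {p. \<bar>fst p\<bar> * (1 + (snd p)\<^sup>2) < 1}"

lemma open_axis_neighbourhood: "open axis_neighbourhood"
  unfolding axis_neighbourhood_def by (intro open_Collect_less continuous_intros)

lemma planar_domain_axis_neighbourhood: "planar_domain axis_neighbourhood"
proof -
  have "starlike axis_neighbourhood"
    unfolding starlike_def
  proof (intro bexI[of _ 0] ballI subsetI)
    fix p q assume p: "p \<in> axis_neighbourhood" and "q \<in> closed_segment 0 p"
    then obtain t where t: "q = t *\<^sub>R p" "0 \<le> t" "t \<le> 1" by (auto simp: in_segment)
    \<comment> \<open>Scaling towards the origin decreases both factors of the defining product,
      hence starlikeness about 0.\<close>
    have "(t * snd p)\<^sup>2 \<le> (snd p)\<^sup>2"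
      using t by (simp add: abs_le_square_iff[symmetric] abs_mult mult_left_le_one_le)
    then have "\<bar>fst q\<bar> * (1 + (snd q)\<^sup>2) \<le> \<bar>fst p\<bar> * (1 + (snd p)\<^sup>2)"
      using t by (intro mult_mono) (auto simp: abs_mult mult_left_le_one_le)
    then show "q \<in> axis_neighbourhood" using p by (simp add: axis_neighbourhood_def)
  qed (simp add: axis_neighbourhood_def)
  then show ?thesis
    using open_axis_neighbourhood
    by (auto simp: planar_domain_def starlike_imp_connected starlike_def)
qed

text \<open>The first bound makes x_u positive for the mixed surface, the second for the maximal
  one. The second rests on 2 |v| \<le> 1 + v^2.\<close>

lemma axis_neighbourhood_bounds:
  assumes "(u, v) \<in> axis_neighbourhood"
  shows "1 + u * v\<^sup>2 > 0" "(u * v)\<^sup>2 < 1"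
proof -
  have *: "\<bar>u\<bar> + \<bar>u\<bar> * v\<^sup>2 < 1" using assms by (simp add: axis_neighbourhood_def algebra_simps)
  have "- (u * v\<^sup>2) \<le> \<bar>u\<bar> * v\<^sup>2"
    using abs_ge_minus_self[of "u * v\<^sup>2"] by (simp add: abs_mult)
  then show "1 + u * v\<^sup>2 > 0" using * by linarith
  have "2 * \<bar>v\<bar> \<le> 1 + v\<^sup>2" using sum_squares_bound[of 1 "\<bar>v\<bar>"] by simp
  then have "\<bar>u\<bar> * (2 * \<bar>v\<bar>) \<le> \<bar>u\<bar> * (1 + v\<^sup>2)" by (rule mult_left_mono) simp
  then have "\<bar>u * v\<bar> < 1" using * by (simp add: abs_mult algebra_simps)
  then show "(u * v)\<^sup>2 < 1" by (simp add: abs_square_less_1)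
qed

section \<open>The two surfaces: derivatives, zero mean curvature and the sign of
  \<open>B_fun\<close>\<close>

text \<open>This is 1 / |1 - i u v|^2, the denominator arising when z = 2 i u / (1 - i u v) is split
  into real and imaginary parts.\<close>

definition recip :: "real \<times> real \<Rightarrow> real" where
  "recip p = inverse (1 + (fst p * snd p)\<^sup>2)"

lemma recip_eq: "recip p * (1 + (fst p * snd p)\<^sup>2) = 1" "recip p > 0"
proof -
  have "1 + (fst p * snd p)\<^sup>2 > 0" by (simp add: add_pos_nonneg)
  then show "recip p * (1 + (fst p * snd p)\<^sup>2) = 1" "recip p > 0"
    by (simp_all add: recip_def)
qed

lemma has_partials_recip:
  "has_partials recip (\<lambda>p. - 2 * fst p * (snd p)\<^sup>2 * (recip p)\<^sup>2)
                      (\<lambda>p. - 2 * (fst p)\<^sup>2 * snd p * (recip p)\<^sup>2)"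
proof -
  have nz: "1 + (fst p * snd p)\<^sup>2 \<noteq> 0" for p :: "real \<times> real"
    by (metis recip_eq(1) mult_zero_right zero_neq_one)
  have "has_partials (\<lambda>p. inverse (1 + (fst p * snd p)\<^sup>2))
      (\<lambda>p. - 2 * fst p * (snd p)\<^sup>2 * (inverse (1 + (fst p * snd p)\<^sup>2))\<^sup>2)
      (\<lambda>p. - 2 * (fst p)\<^sup>2 * snd p * (inverse (1 + (fst p * snd p)\<^sup>2))\<^sup>2)"
    by (rule has_partials_eqI, rule has_partials_inverse, (rule has_partials_intros)+, rule nz)
      (simp_all add: fun_eq_iff power2_eq_square algebra_simps)
  then show ?thesis by (simp add: recip_def[abs_def])
qed

text \<open>Derivatives produced by the rules match the simplified closed forms only modulo the
  relation defining \<open>recip\<close>, which is therefore supplied as a hypothesis for the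
  algebra.\<close>

lemma has_partials_recip_eqI:
  assumes "has_partials g gu gv"
    and "\<And>p. recip p * (1 + (fst p * snd p)\<^sup>2) = 1 \<Longrightarrow> gu p = gu' p"
    and "\<And>p. recip p * (1 + (fst p * snd p)\<^sup>2) = 1 \<Longrightarrow> gv p = gv' p"
  shows "has_partials g gu' gv'"
  by (rule has_partials_eqI[OF assms(1)]) (simp_all add: assms(2,3) recip_eq(1))

text \<open>Division by constants is written as multiplication because the rules for partial derivatives
  are applied syntactically.\<close>

interpretation maximal: light_cone_map
  "\<lambda>p. fst p * recip p"
  "\<lambda>p. (1 - (fst p)\<^sup>2 * (snd p)\<^sup>2) * recip p ^ 2"
  "\<lambda>p. - 2 * fst p ^ 3 * snd p * recip p ^ 2"
  "\<lambda>p. fst p * snd p ^ 2 * (2 * fst p ^ 2 * snd p ^ 2 - 6) * recip p ^ 3"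
  "\<lambda>p. fst p ^ 2 * snd p * (2 * fst p ^ 2 * snd p ^ 2 - 6) * recip p ^ 3"
  "\<lambda>p. fst p ^ 3 * (6 * fst p ^ 2 * snd p ^ 2 - 2) * recip p ^ 3"
  "\<lambda>p. snd p * fst p ^ 4 * (fst p ^ 2 * snd p ^ 2 - 3) * recip p ^ 3 * (1 / 12)"
  "\<lambda>p. fst p ^ 3 * snd p * (fst p ^ 2 * snd p ^ 2 - 1) * recip p ^ 4"
  "\<lambda>p. fst p ^ 4 * (6 * fst p ^ 2 * snd p ^ 2 - fst p ^ 4 * snd p ^ 4 - 1) * recip p ^ 4 * (1 / 4)"
  "\<lambda>p. fst p ^ 2 * snd p * (10 * fst p ^ 2 * snd p ^ 2 - 3 * fst p ^ 4 * snd p ^ 4 - 3) * recip p ^ 5"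
  "\<lambda>p. fst p ^ 3 * (10 * fst p ^ 2 * snd p ^ 2 - 5 * fst p ^ 4 * snd p ^ 4 - 1) * recip p ^ 5"
  "\<lambda>p. fst p ^ 6 * snd p * (fst p ^ 4 * snd p ^ 4 - 10 * fst p ^ 2 * snd p ^ 2 + 5) * recip p ^ 5"
proof ((unfold_locales; rule has_partials_recip_eqI, ((rule has_partials_intros has_partials_recip)+)[1]),
    simp_all (no_asm) only: pred_numeral_simps Num.BitM.simps numeral_One)
qed (algebra | (simp (no_asm) add: algebra_simps power_numeral_reduce; fail))+

text \<open>Here p + q = u v and p q = - u, so x = (p^2 + q^2) / 2 and b = (p^5 + q^5) / 20 are
  power sums written in the elementary symmetric functions.\<close>

interpretation mixed: light_cone_map
  "\<lambda>p. fst p + fst p ^ 2 * snd p ^ 2 * (1 / 2)"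
  "\<lambda>p. 1 + fst p * snd p ^ 2"
  "\<lambda>p. fst p ^ 2 * snd p"
  "\<lambda>p. snd p ^ 2"
  "\<lambda>p. 2 * fst p * snd p"
  "\<lambda>p. fst p ^ 2"
  "\<lambda>p. fst p ^ 3 * snd p * (1 / 4) + fst p ^ 4 * snd p ^ 3 * (1 / 4) + fst p ^ 5 * snd p ^ 5 * (1 / 20)"
  "\<lambda>p. fst p ^ 2 * snd p * (3 / 4) + fst p ^ 3 * snd p ^ 3 + fst p ^ 4 * snd p ^ 5 * (1 / 4)"
  "\<lambda>p. fst p ^ 3 * (1 / 4) + fst p ^ 4 * snd p ^ 2 * (3 / 4) + fst p ^ 5 * snd p ^ 4 * (1 / 4)"
  "\<lambda>p. fst p * snd p * (3 / 2) + 3 * fst p ^ 2 * snd p ^ 3 + fst p ^ 3 * snd p ^ 5"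
  "\<lambda>p. fst p ^ 2 * (3 / 4) + 3 * fst p ^ 3 * snd p ^ 2 + fst p ^ 4 * snd p ^ 4 * (5 / 4)"
  "\<lambda>p. fst p ^ 4 * snd p * (3 / 2) + fst p ^ 5 * snd p ^ 3"
proof ((unfold_locales; rule has_partials_eqI, ((rule has_partials_intros)+)[1]),
    simp_all (no_asm) only: pred_numeral_simps Num.BitM.simps numeral_One)
qed algebra+

text \<open>With the closed forms above, the equation is a polynomial identity in which
  \<open>recip p\<close> can be treated as an independent variable.\<close>

lemma maximal_A: "A_fun maximal.f p = 0"
  unfolding maximal.A_fun_f by algebra

text \<open>Since - 2 / z = v + i / u, the parameter lines are orthogonal: the term
  \<open>Xu p * Xv p - 2 * bu p\<close> vanishes and the determinant is a product of two squares,
  visibly nonnegative and zero on the axis.\<close>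

lemma maximal_B:
  "B_fun maximal.f p = fst p ^ 4 * recip p ^ 8 * (1 - fst p ^ 2 * snd p ^ 2) ^ 4"
  unfolding maximal.B_fun_f by (simp add: algebra_simps power_numeral_reduce)

lemma mixed_A: "A_fun mixed.f p = 0"
  unfolding mixed.A_fun_f by algebra

section \<open>Embeddedness of both surfaces\<close>

lemma smooth_embedding_maximal: "smooth_embedding axis_neighbourhood maximal.f"
\<comment> \<open>Solves x = u / (1 + u^2 v^2), a quadratic equation v^2 x u^2 - u + x = 0 for u.
  The rationalised root stays defined at v = 0 and x = 0.\<close>
proof (rule maximal.smooth_embedding_f[where s = "\<lambda>x v. 2 * x / (1 + sqrt (1 - 4 * v\<^sup>2 * x\<^sup>2))"])
  \<comment> \<open>The radicand is a perfect square because (1 + w^2)^2 - 4 w^2 = (1 - w^2)^2 with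
    w = u v; the bound w^2 < 1 fixes the sign of the root.\<close>
  have sqrt_eq: "sqrt (1 - 4 * (snd p)\<^sup>2 * (fst p * recip p)\<^sup>2) = (1 - (fst p * snd p)\<^sup>2) * recip p"
    if "p \<in> axis_neighbourhood" for p
  proof (rule real_sqrt_unique)
    show "((1 - (fst p * snd p)\<^sup>2) * recip p)\<^sup>2 = 1 - 4 * (snd p)\<^sup>2 * (fst p * recip p)\<^sup>2"
      using recip_eq(1)[of p] by algebra
    show "0 \<le> (1 - (fst p * snd p)\<^sup>2) * recip p"
      using that axis_neighbourhood_bounds(2)[of "fst p" "snd p"] recip_eq(2)[of p] by simp
  qed
  \<comment> \<open>The denominator of \<open>s\<close> on the image is thus 2
    \<open>recip p\<close>, which is positive; this gives both the inversion formula and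
    continuity.\<close>
  have sum_eq: "1 + (1 - (fst p * snd p)\<^sup>2) * recip p = 2 * recip p" for p
    using recip_eq(1)[of p] by algebra
  have "smooth_on axis_neighbourhood recip"
    unfolding recip_def[abs_def]
    by (intro smooth_on_intros open_axis_neighbourhood) (metis recip_eq(1) mult_zero_right zero_neq_one)
  then show "smooth_on axis_neighbourhood (\<lambda>p. fst p * recip p)"
    "smooth_on axis_neighbourhood (\<lambda>p. snd p * fst p ^ 4 * (fst p ^ 2 * snd p ^ 2 - 3) * recip p ^ 3 * (1 / 12))"
    by (intro smooth_on_intros open_axis_neighbourhood; simp)+
  show "(1 - (fst p)\<^sup>2 * (snd p)\<^sup>2) * (recip p)\<^sup>2 \<noteq> 0" if "p \<in> axis_neighbourhood" for p
    using that axis_neighbourhood_bounds(2)[of "fst p" "snd p"] recip_eq(2)[of p]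
    by (simp add: power_mult_distrib)
  show "2 * (fst p * recip p) / (1 + sqrt (1 - 4 * (snd p)\<^sup>2 * (fst p * recip p)\<^sup>2)) = fst p"
    if "p \<in> axis_neighbourhood" for p
    using recip_eq(2)[of p] unfolding sqrt_eq[OF that] sum_eq by simp
  have "1 + sqrt (1 - 4 * ((x $ 2 + x $ 3) / 2)\<^sup>2 * (x $ 1)\<^sup>2) \<noteq> 0" if mem: "x \<in> maximal.f ` axis_neighbourhood" for x
  proof -
    obtain p where p: "p \<in> axis_neighbourhood" "x = maximal.f p" using mem by blast
    have x: "x $ 1 = fst p * recip p" "(x $ 2 + x $ 3) / 2 = snd p"
      unfolding p(2) maximal.f_def by simp_all
    show ?thesis
      using recip_eq(2)[of p] unfolding x sqrt_eq[OF p(1)] sum_eq by simp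
  qed
  then show "continuous_on (maximal.f ` axis_neighbourhood)
     (\<lambda>x. 2 * x $ 1 / (1 + sqrt (1 - 4 * ((x $ 2 + x $ 3) / 2)\<^sup>2 * (x $ 1)\<^sup>2)))"
    by (intro continuous_intros) auto
qed (rule open_axis_neighbourhood)

lemma smooth_embedding_mixed: "smooth_embedding axis_neighbourhood mixed.f"
\<comment> \<open>The rationalised root of v^2 u^2 / 2 + u - x = 0. Its radicand is the square of 1
  + u v^2, which is positive on the domain.\<close>
proof (rule mixed.smooth_embedding_f[where s = "\<lambda>x v. 2 * x / (1 + sqrt (1 + 2 * v\<^sup>2 * x))"])
  have pos: "1 + fst p * (snd p)\<^sup>2 > 0" if "p \<in> axis_neighbourhood" for p
    using that axis_neighbourhood_bounds(1)[of "fst p" "snd p"] by simp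
  have sqrt_eq: "sqrt (1 + 2 * (snd p)\<^sup>2 * (fst p + (fst p)\<^sup>2 * (snd p)\<^sup>2 * (1 / 2))) = 1 + fst p * (snd p)\<^sup>2"
    if "p \<in> axis_neighbourhood" for p
  proof (rule real_sqrt_unique)
    show "(1 + fst p * (snd p)\<^sup>2)\<^sup>2 = 1 + 2 * (snd p)\<^sup>2 * (fst p + (fst p)\<^sup>2 * (snd p)\<^sup>2 * (1 / 2))"
      by algebra
  qed (use pos[OF that] in simp)
  show "smooth_on axis_neighbourhood (\<lambda>p. fst p + (fst p)\<^sup>2 * (snd p)\<^sup>2 * (1 / 2))"
    "smooth_on axis_neighbourhood (\<lambda>p. fst p ^ 3 * snd p * (1 / 4) + fst p ^ 4 * snd p ^ 3 * (1 / 4)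
       + fst p ^ 5 * snd p ^ 5 * (1 / 20))"
    by (intro smooth_on_intros open_axis_neighbourhood)+
  show "1 + fst p * (snd p)\<^sup>2 \<noteq> 0" if "p \<in> axis_neighbourhood" for p
    using pos[OF that] by simp
  show "2 * (fst p + (fst p)\<^sup>2 * (snd p)\<^sup>2 * (1 / 2)) /
      (1 + sqrt (1 + 2 * (snd p)\<^sup>2 * (fst p + (fst p)\<^sup>2 * (snd p)\<^sup>2 * (1 / 2)))) = fst p"
    if "p \<in> axis_neighbourhood" for p
    using pos[OF that] unfolding sqrt_eq[OF that]
    by (simp add: divide_eq_eq) (simp add: algebra_simps power2_eq_square)
  have "1 + sqrt (1 + 2 * ((x $ 2 + x $ 3) / 2)\<^sup>2 * x $ 1) \<noteq> 0" if mem: "x \<in> mixed.f ` axis_neighbourhood" for x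
  proof -
    obtain p where p: "p \<in> axis_neighbourhood" "x = mixed.f p" using mem by blast
    have x: "x $ 1 = fst p + (fst p)\<^sup>2 * (snd p)\<^sup>2 * (1 / 2)" "(x $ 2 + x $ 3) / 2 = snd p"
      unfolding p(2) mixed.f_def by simp_all
    show ?thesis
      using pos[OF p(1)] unfolding x sqrt_eq[OF p(1)] by simp
  qed
  then show "continuous_on (mixed.f ` axis_neighbourhood)
     (\<lambda>x. 2 * x $ 1 / (1 + sqrt (1 + 2 * ((x $ 2 + x $ 3) / 2)\<^sup>2 * x $ 1)))"
    by (intro continuous_intros) auto
qed (rule open_axis_neighbourhood)

section \<open>Causal types and conclusion\<close>

lemma maximal_type_maximal: "maximal_type axis_neighbourhood maximal.f"
proof -
  \<comment> \<open>On v = 0 the determinant reduces to u^4.\<close>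
  have "B_fun maximal.f (1/2, 0) \<noteq> 0"
    unfolding maximal_B using recip_eq(2)[of "(1/2, 0)"] by simp
  moreover have "(1/2, 0) \<in> axis_neighbourhood" by (simp add: axis_neighbourhood_def)
  moreover have "B_fun maximal.f p \<ge> 0" for p
    unfolding maximal_B by simp
  ultimately show ?thesis
    unfolding maximal_type_def
    using ZMC_map_if_smooth_embedding[OF planar_domain_axis_neighbourhood smooth_embedding_maximal] maximal_A
    by blast
qed

text \<open>The parameters p, q are the roots of z^2 - u v z - u, with discriminant u (u v^2 + 4):
  on the domain they are real for u > 0 and complex conjugate for u < 0. On v = 0 the determinant is
  - u^3, which changes sign across the axis.\<close>

lemma mixed_type_mixed: "mixed_type axis_neighbourhood mixed.f"
proof -
  have "B_fun mixed.f (- 1/2, 0) > 0" "B_fun mixed.f (1/2, 0) < 0"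
    unfolding mixed.B_fun_f by simp_all
  moreover have "(- 1/2, 0) \<in> axis_neighbourhood" "(1/2, 0) \<in> axis_neighbourhood"
    by (simp_all add: axis_neighbourhood_def)
  ultimately show ?thesis
    unfolding mixed_type_def
    using ZMC_map_if_smooth_embedding[OF planar_domain_axis_neighbourhood smooth_embedding_mixed] mixed_A
    by blast
qed

theorem theorem1p4:
  shows "(\<exists>(U :: (real \<times> real) set) (f :: real \<times> real \<Rightarrow> real^3).
            planar_domain U \<and> smooth_embedding U f \<and> ZMC_map U f \<and> maximal_type U f \<and>
            contains_entire_null_line U f) \<and>
         (\<exists>(U :: (real \<times> real) set) (f :: real \<times> real \<Rightarrow> real^3).
            planar_domain U \<and> smooth_embedding U f \<and> ZMC_map U f \<and> mixed_type U f \<and>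
            contains_entire_null_line U f)"
proof (intro conjI exI)
  have axis: "(0, v) \<in> axis_neighbourhood" for v by (simp add: axis_neighbourhood_def)
  show "contains_entire_null_line axis_neighbourhood maximal.f"
    by (rule maximal.contains_entire_null_line_f; (unfold maximal_B)?; simp add: axis)
  show "contains_entire_null_line axis_neighbourhood mixed.f"
    by (rule mixed.contains_entire_null_line_f; (unfold mixed.B_fun_f)?; simp add: axis)
  show "ZMC_map axis_neighbourhood maximal.f" "ZMC_map axis_neighbourhood mixed.f"
    using maximal_type_maximal mixed_type_mixed by (auto simp: maximal_type_def mixed_type_def)
qed (rule planar_domain_axis_neighbourhood smooth_embedding_maximal smooth_embedding_mixed
    maximal_type_maximal mixed_type_mixed)+

end
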